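(* For every integer $k\geq 2$, $$r(K_3,K_3:k)=3k+2.$$ That is, $3k+2$ is the least number $p$ of vertices such that every red-blue coloring of the edges of the complete graph $K_p$ contains at least $k$ pairwise vertex-disjoint monochromatic triangles (each triangle being red or blue, and different triangles being allowed to have different colors).
   Context: Graphs are finite and simple. A $2$-coloring of a graph assigns to each edge one of the colors red, blue. A subgraph is monochromatic if all its edges have the same color. Two subgraphs are disjoint if they share no vertex. For graphs $G_1,G_2$ and a positive integer $k$, $r(G_1,G_2:k)$ denotes the least number $p$ of vertices such that every $2$-coloring of the edges of $K_p$ contains a total of at least $k$ pairwise disjoint subgraphs each of which is either red and isomorphic to $G_1$ or blue and isomorphic to $G_2$. *)

theory Defs
  imports "HOL-Library.Ramsey"
begin

type_synonym 'a graph = "'a set \<times> 'a set set"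

abbreviation verts :: "'a graph \<Rightarrow> 'a set" where
  "verts G \<equiv> fst G"

abbreviation edges :: "'a graph \<Rightarrow> 'a set set" where
  "edges G \<equiv> snd G"

definition simple_graph :: "'a graph \<Rightarrow> bool" where
  "simple_graph G \<longleftrightarrow> finite (verts G) \<and> edges G \<subseteq> [verts G]\<^bsup>2\<^esup>"

definition subgraph :: "'a graph \<Rightarrow> 'a graph \<Rightarrow> bool" where
  "subgraph H G \<longleftrightarrow> simple_graph H \<and> verts H \<subseteq> verts G \<and> edges H \<subseteq> edges G"

definition graph_iso :: "'a graph \<Rightarrow> 'b graph \<Rightarrow> bool" where
  "graph_iso G H \<longleftrightarrow>
     (\<exists>f. bij_betw f (verts G) (verts H) \<and> (\<lambda>e. f ` e) ` edges G = edges H)"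

definition complete_graph :: "nat \<Rightarrow> nat graph" where
  "complete_graph n = ({..<n}, [{..<n}]\<^bsup>2\<^esup>)"

datatype colour = Red | Blue

(* A colouring is a total function on vertex sets; only its values on edges matter. *)
definition all_edges_coloured :: "('a set \<Rightarrow> colour) \<Rightarrow> colour \<Rightarrow> 'a graph \<Rightarrow> bool" where
  "all_edges_coloured c x H \<longleftrightarrow> (\<forall>e\<in>edges H. c e = x)"

definition coloured_copy ::
  "('v set \<Rightarrow> colour) \<Rightarrow> 'a graph \<Rightarrow> 'b graph \<Rightarrow> 'v graph \<Rightarrow> bool" where
  "coloured_copy c G1 G2 H \<longleftrightarrow>
     all_edges_coloured c Red H \<and> graph_iso H G1 \<or>
     all_edges_coloured c Blue H \<and> graph_iso H G2"

definition forces_disjoint_copies :: "'a graph \<Rightarrow> 'b graph \<Rightarrow> nat \<Rightarrow> nat \<Rightarrow> bool" where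
  "forces_disjoint_copies G1 G2 k p \<longleftrightarrow>
     (\<forall>c :: nat set \<Rightarrow> colour. \<exists>F.
        finite F \<and> card F \<ge> k \<and>
        pairwise (\<lambda>H H'. verts H \<inter> verts H' = {}) F \<and>
        (\<forall>H\<in>F. subgraph H (complete_graph p) \<and> coloured_copy c G1 G2 H))"

definition disjoint_ramsey :: "'a graph \<Rightarrow> 'b graph \<Rightarrow> nat \<Rightarrow> nat" where
  "disjoint_ramsey G1 G2 k = (LEAST p. forces_disjoint_copies G1 G2 k p)"

lemma disjoint_copies_in_clique:
  fixes G :: "'a graph" and c :: "nat set \<Rightarrow> colour"
  assumes G: "simple_graph G" "verts G \<noteq> {}"
    and R: "R \<subseteq> {..<p}" "card R = k * card (verts G)"
    and mono: "\<And>e. e \<in> [R]\<^bsup>2\<^esup> \<Longrightarrow> c e = x"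
  shows "\<exists>F. finite F \<and> card F \<ge> k \<and>
           pairwise (\<lambda>H H'. verts H \<inter> verts H' = {}) F \<and>
           (\<forall>H\<in>F. subgraph H (complete_graph p) \<and> all_edges_coloured c x H \<and> graph_iso H G)"
proof -
  have fin: "finite (verts G)" and E: "edges G \<subseteq> [verts G]\<^bsup>2\<^esup>"
    using G by (auto simp: simple_graph_def)
  have finR: "finite R" using R finite_subset by blast
  have "card ({..<k} \<times> verts G) = card R" by (simp add: R card_cartesian_product)
  then obtain g where g: "bij_betw g ({..<k} \<times> verts G) R"
    using finite_same_card_bij[of "{..<k} \<times> verts G" R] fin finR by auto
  define h where "h = (\<lambda>i v. g (i, v))"
  define H where "H = (\<lambda>i. (h i ` verts G, (\<lambda>e. h i ` e) ` edges G))"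
  have hR: "h i v \<in> R" if "i < k" "v \<in> verts G" for i v
    using g that by (auto simp: h_def bij_betw_def)
  have hinj: "i = j \<and> v = w"
    if "h i v = h j w" "i < k" "j < k" "v \<in> verts G" "w \<in> verts G" for i j v w
    using g that by (auto simp: h_def bij_betw_def inj_on_def)
  have inj: "inj_on (h i) (verts G)" if "i < k" for i
    using hinj that by (auto simp: inj_on_def)
  have disj: "verts (H i) \<inter> verts (H j) = {}" if "i < k" "j < k" "i \<noteq> j" for i j
    using hinj that by (force simp: H_def)
  have "inj_on H {..<k}"
  proof (rule inj_onI)
    fix i j assume ij: "i \<in> {..<k}" "j \<in> {..<k}" "H i = H j"
    moreover have "verts (H i) \<noteq> {}" using G by (simp add: H_def)
    ultimately show "i = j" using disj[of i j] by auto
  qed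
  then have card: "card (H ` {..<k}) = k" by (simp add: card_image)
  have edge: "h i ` e \<in> [h i ` verts G]\<^bsup>2\<^esup>" if "i < k" "e \<in> edges G" for i e
  proof -
    have e: "e \<subseteq> verts G" "finite e" "card e = 2" using that E by (auto simp: nsets_def)
    moreover have "card (h i ` e) = card e"
      using inj[OF that(1)] e by (intro card_image) (blast intro: inj_on_subset)
    ultimately show ?thesis by (auto simp: nsets_def)
  qed
  have VR: "h i ` verts G \<subseteq> R" if "i < k" for i using hR that by blast
  have simple: "simple_graph (H i)" if "i < k" for i
    using edge that fin by (auto simp: simple_graph_def H_def)
  have edgeR: "edges (H i) \<subseteq> [R]\<^bsup>2\<^esup>" if "i < k" for i
    using edge[OF that] nsets_mono[OF VR[OF that]] by (force simp: H_def)
  have sub: "subgraph (H i) (complete_graph p)" if "i < k" for i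
    using simple[OF that] edgeR[OF that] nsets_mono[OF R(1), of 2] VR[OF that] R(1)
    unfolding subgraph_def complete_graph_def by (simp add: H_def) blast
  have col: "all_edges_coloured c x (H i)" if "i < k" for i
    using edgeR[OF that] mono by (auto simp: all_edges_coloured_def)
  have iso: "graph_iso (H i) G" if "i < k" for i
    unfolding graph_iso_def
  proof (intro exI conjI)
    let ?f = "inv_into (verts G) (h i)"
    show "bij_betw ?f (verts (H i)) (verts G)"
      using inj[OF that] by (simp add: H_def bij_betw_inv_into inj_on_imp_bij_betw)
    have "?f ` (h i ` e) = e" if "e \<in> edges G" for e
    proof (rule inv_into_image_cancel[OF inj[OF \<open>i < k\<close>]])
      show "e \<subseteq> verts G" using that E by (auto simp: nsets_def)
    qed
    then show "(\<lambda>e. ?f ` e) ` edges (H i) = edges G"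
      by (force simp: H_def image_image)
  qed
  have "pairwise (\<lambda>H H'. verts H \<inter> verts H' = {}) (H ` {..<k})"
    unfolding pairwise_def using disj by (metis imageE lessThan_iff)
  moreover have "\<forall>H'\<in>H ` {..<k}. subgraph H' (complete_graph p) \<and> all_edges_coloured c x H' \<and> graph_iso H' G"
    using sub col iso by blast
  moreover have "finite (H ` {..<k})" by simp
  ultimately show ?thesis using card by (intro exI[of _ "H ` {..<k}"]) simp
qed

(* The set over which LEAST ranges is nonempty, so the number is well defined. *)
lemma forces_disjoint_copies_exists:
  fixes G1 :: "'a graph" and G2 :: "'b graph"
  assumes "simple_graph G1" "verts G1 \<noteq> {}" "simple_graph G2" "verts G2 \<noteq> {}"
  shows "\<exists>p. forces_disjoint_copies G1 G2 k p"
proof -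
  obtain p :: nat where p: "partn_lst {..<p} [k * card (verts G1), k * card (verts G2)] 2"
    using ramsey2_full by blast
  have "forces_disjoint_copies G1 G2 k p"
    unfolding forces_disjoint_copies_def
  proof
    fix c :: "nat set \<Rightarrow> colour"
    define f where "f = (\<lambda>e. case c e of Red \<Rightarrow> 0 | Blue \<Rightarrow> (1::nat))"
    have "f \<in> [{..<p}]\<^bsup>2\<^esup> \<rightarrow> {..<2}" by (auto simp: f_def split: colour.splits)
    then have "\<exists>i<2. monochromatic {..<p} ([k * card (verts G1), k * card (verts G2)] ! i) 2 f i"
      using p by (simp add: partn_lst_def numeral_2_eq_2)
    then obtain i R where i: "i < 2"
      and R: "R \<in> nsets {..<p} ([k * card (verts G1), k * card (verts G2)] ! i)"
      and fi: "f ` [R]\<^bsup>2\<^esup> \<subseteq> {i}"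
      unfolding monochromatic_def by blast
    have Rp: "R \<subseteq> {..<p}" using R by (auto simp: nsets_def)
    consider "i = 0" | "i = 1" using i by linarith
    then show "\<exists>F. finite F \<and> card F \<ge> k \<and>
        pairwise (\<lambda>H H'. verts H \<inter> verts H' = {}) F \<and>
        (\<forall>H\<in>F. subgraph H (complete_graph p) \<and> coloured_copy c G1 G2 H)"
    proof cases
      case 1
      have "card R = k * card (verts G1)" using R 1 by (auto simp: nsets_def)
      moreover have "c e = Red" if "e \<in> [R]\<^bsup>2\<^esup>" for e
        using fi that 1 by (cases "c e") (auto simp: f_def)
      ultimately obtain F where "finite F" "card F \<ge> k"
        "pairwise (\<lambda>H H'. verts H \<inter> verts H' = {}) F"
        "\<forall>H\<in>F. subgraph H (complete_graph p) \<and> all_edges_coloured c Red H \<and> graph_iso H G1"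
        using disjoint_copies_in_clique[OF assms(1,2) Rp, of k c Red] by auto
      then show ?thesis
        by (intro exI[of _ F] conjI) (auto simp only: coloured_copy_def)
    next
      case 2
      have "card R = k * card (verts G2)" using R 2 by (auto simp: nsets_def)
      moreover have "c e = Blue" if "e \<in> [R]\<^bsup>2\<^esup>" for e
        using fi that 2 by (cases "c e") (auto simp: f_def)
      ultimately obtain F where "finite F" "card F \<ge> k"
        "pairwise (\<lambda>H H'. verts H \<inter> verts H' = {}) F"
        "\<forall>H\<in>F. subgraph H (complete_graph p) \<and> all_edges_coloured c Blue H \<and> graph_iso H G2"
        using disjoint_copies_in_clique[OF assms(3,4) Rp, of k c Blue] by auto
      then show ?thesis
        by (intro exI[of _ F] conjI) (auto simp only: coloured_copy_def)
    qed
  qed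
  then show ?thesis ..
qed

end

theory Submission
  imports Defs
begin

text \<open>
  Upper bound: a set of at least six vertices contains a monochromatic triangle, so removing one
  reduces \<open>k + 1\<close> to \<open>k\<close>, and only \<open>K\<^sub>8\<close> with \<open>k = 2\<close> remains. If \<open>K\<^sub>8\<close> has no two
  disjoint monochromatic triangles, then the five vertices outside a red triangle \<open>abc\<close> carry no
  monochromatic triangle, hence form a red pentagon \<open>p q s t u\<close> with blue diagonals. A blue
  triangle on \<open>a\<close> and two pentagon vertices is incompatible with \<open>bc\<close> being red, so \<open>a\<close> lies
  in a red triangle with some pentagon side \<open>pq\<close>; this determines the edges from \<open>b\<close> and \<open>c\<close>
  to the pentagon and produces two disjoint red triangles.

  Lower bound: in \<open>K\<^bsub>3k+1\<^esub>\<close> colour red the edge joining two special vertices and all edges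
  avoiding both, and the others blue. No monochromatic triangle meets the special vertices, which
  leaves room for at most \<open>k - 1\<close> disjoint triangles.
\<close>

section \<open>Monochromatic triangles and the pentagon colouring\<close>

text \<open>Red is the relation \<open>r\<close> and blue its negation, so exchanging colours means
  negating \<open>r\<close>; symmetry of \<open>r\<close> is assumed separately.\<close>

definition mono3 :: "('a \<Rightarrow> 'a \<Rightarrow> bool) \<Rightarrow> 'a set \<Rightarrow> bool" where
  "mono3 r T \<longleftrightarrow> card T = 3 \<and>
     (\<exists>b. \<forall>u\<in>T. \<forall>v\<in>T. u \<noteq> v \<longrightarrow> r u v = b)"

text \<open>The triangle-free colouring of the complete graph on five vertices. The diagonals are
  listed along the blue cycle \<open>p s u q t\<close>, so rotation only permutes the
  conjuncts.\<close>

definition pentagon :: "('a \<Rightarrow> 'a \<Rightarrow> bool) \<Rightarrow> 'a \<Rightarrow> 'a \<Rightarrow> 'a \<Rightarrow> 'a \<Rightarrow> 'a \<Rightarrow> bool" where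
  "pentagon r p q s t u \<longleftrightarrow> distinct [p, q, s, t, u] \<and>
     r p q \<and> r q s \<and> r s t \<and> r t u \<and> r u p \<and>
     \<not> r p s \<and> \<not> r s u \<and> \<not> r u q \<and> \<not> r q t \<and> \<not> r t p"

lemma pentagon_rotate:
  assumes "pentagon r p q s t u"
  shows "pentagon r q s t u p" "pentagon r s t u p q" "pentagon r t u p q s" "pentagon r u p q s t"
  using assms by (auto simp: pentagon_def)

text \<open>Colour symmetry, which later allows a given triangle to be taken red.\<close>

lemma mono3_compl: "mono3 (\<lambda>u v. \<not> r u v) T \<longleftrightarrow> mono3 r T"
proof -
  have "mono3 (\<lambda>u v. \<not> r u v) T" if m: "mono3 r T" for r :: "'a \<Rightarrow> 'a \<Rightarrow> bool"
  proof -
    obtain b where "\<forall>u\<in>T. \<forall>v\<in>T. u \<noteq> v \<longrightarrow> r u v = b"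
      using m by (auto simp: mono3_def)
    then have "\<forall>u\<in>T. \<forall>v\<in>T. u \<noteq> v \<longrightarrow> (\<not> r u v) = (\<not> b)" by blast
    then show ?thesis using m unfolding mono3_def by blast
  qed
  from this[of r] this[of "\<lambda>u v. \<not> r u v"] show ?thesis by auto
qed

lemma mono3_triple:
  assumes "symp r" "distinct [x, y, z]"
  shows "mono3 r {x, y, z} \<longleftrightarrow> r x y = r y z \<and> r y z = r x z"
  using assms unfolding mono3_def symp_def by auto

text \<open>Here \<open>q u\<close> must be blue and \<open>s t\<close> red. Hence each of
  \<open>s\<close>, \<open>t\<close> has a red edge to \<open>q\<close> or \<open>u\<close>, and
  neither \<open>q\<close> nor \<open>u\<close> has two such edges: a red perfect matching, whose
  two possibilities are the two pentagons.\<close>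

lemma pentagon_aux:
  assumes r: "symp r" and d: "distinct [p, q, s, t, u]"
    and no: "\<And>T. T \<subseteq> {p, q, s, t, u} \<Longrightarrow> \<not> mono3 r T"
    and e: "r p q" "r p u" "\<not> r p s" "\<not> r p t"
  shows "pentagon r p q s t u \<or> pentagon r p q t s u"
proof -
  have sym: "r x y \<longleftrightarrow> r y x" for x y using r by (auto simp: symp_def)
  have n: "\<not> (r x y = r y z \<and> r y z = r x z)"
    if "distinct [x, y, z]" "{x, y, z} \<subseteq> {p, q, s, t, u}" for x y z
    using mono3_triple[OF r that(1)] no[OF that(2)] by blast
  have "\<not> r q u" using n[of p q u] d e by auto
  moreover have "r s t" using n[of p s t] d e by auto
  moreover have "\<not> (r q s \<and> r q t)" "\<not> (r u s \<and> r u t)"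
    using n[of q s t] n[of u s t] d \<open>r s t\<close> by auto
  moreover have "r q s \<or> r u s" "r q t \<or> r u t"
    using n[of q u s] n[of q u t] d \<open>\<not> r q u\<close> sym by auto
  ultimately show ?thesis
    using d e sym unfolding pentagon_def by auto
qed

lemma pentagon_exists:
  assumes r: "symp r" and P: "card P = 5"
    and no: "\<And>T. T \<subseteq> P \<Longrightarrow> \<not> mono3 r T"
  obtains p q s t u where "pentagon r p q s t u" "P = {p, q, s, t, u}"
proof -
  note pent = that
  have fin: "finite P" using P card.infinite by fastforce
  then obtain xs where xs: "set xs = P" "distinct xs"
    using finite_distinct_list by blast
  then have "length xs = 5" using P distinct_card by fastforce
  then obtain a b c d e where l: "xs = [a, b, c, d, e]"
    by (auto simp: numeral_eq_Suc length_Suc_conv)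
  have D: "distinct [a, b, c, d, e]" and PE: "P = {a, b, c, d, e}" using xs l by auto
  \<comment> \<open>Otherwise some edge among \<open>y\<close>, \<open>z\<close>, \<open>w\<close>
    has the common colour and closes a triangle with \<open>a\<close>, or \<open>y z w\<close>
    itself is monochromatic.\<close>
  have n: "\<not> (r a y = r a z \<and> r a z = r a w \<and> r a w = i)"
    if "distinct [a, y, z, w]" "{y, z, w} \<subseteq> P" for y z w i
  proof -
    have "\<not> mono3 r {a, y, z}" "\<not> mono3 r {a, y, w}" "\<not> mono3 r {a, z, w}" "\<not> mono3 r {y, z, w}"
      using no that PE by auto
    then show ?thesis using that(1) by (auto simp: mono3_triple[OF r])
  qed
  have aux: thesis
    if "distinct [a, y, z, w, x]" "{a, y, z, w, x} = P" "r a y" "r a x" "\<not> r a z" "\<not> r a w" for y z w x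
  proof -
    have "pentagon r a y z w x \<or> pentagon r a y w z x"
      using pentagon_aux[OF r that(1) _ that(3,4,5,6)] no that(2) by blast
    moreover have "P = {a, y, z, w, x}" "P = {a, y, w, z, x}" using that(2) by auto
    ultimately show thesis using pent by blast
  qed
  \<comment> \<open>By \<open>n\<close>, exactly two edges at \<open>a\<close> are red; the six
    instances of \<open>aux\<close> are the choices of the red pair.\<close>
  show thesis
    using n[of b c d] n[of b c e] n[of b d e] n[of c d e] D PE
      aux[of b d e c] aux[of b c e d] aux[of b c d e]
      aux[of c b e d] aux[of c b d e] aux[of d b c e]
    by (auto simp: insert_commute)
qed

text \<open>The blue neighbours of \<open>a\<close> are independent in the blue 5-cycle of
  diagonals, so there are at most two. The three or more red ones include both ends of a side, which
  is rotated to \<open>p' q'\<close>.\<close>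

lemma pentagon_extend:
  assumes r: "symp r" and p: "pentagon r p q s t u" and a: "a \<notin> {p, q, s, t, u}"
    and no: "\<And>x y. {x, y} \<subseteq> {p, q, s, t, u} \<Longrightarrow> \<not> r x y \<Longrightarrow> \<not> r a x \<Longrightarrow> \<not> r a y \<Longrightarrow> x = y"
  obtains p' q' s' t' u' where "pentagon r p' q' s' t' u'"
    "{p', q', s', t', u'} = {p, q, s, t, u}" "r a p'" "r a q'"
proof -
  have cone: "r a x \<or> r a y" if "\<not> r x y" "x \<noteq> y" "{x, y} \<subseteq> {p, q, s, t, u}" for x y
    using no that by blast
  have "r a p \<or> r a s" "r a s \<or> r a u" "r a u \<or> r a q" "r a q \<or> r a t" "r a t \<or> r a p"
    using p cone[of p s] cone[of s u] cone[of u q] cone[of q t] cone[of t p]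
    by (auto simp add: pentagon_def)
  then consider "r a p \<and> r a q" | "r a q \<and> r a s" | "r a s \<and> r a t" | "r a t \<and> r a u"
    | "r a u \<and> r a p" by blast
  then show thesis
    by cases (use p pentagon_rotate[OF p] that in \<open>blast+\<close>)
qed

text \<open>The Ramsey bound R(3,3) \<le> 6: if five of six vertices form a pentagon, the sixth is
  red to both ends of some side.\<close>

lemma mono3_exists:
  assumes r: "symp r" and V: "card V \<ge> 6"
  obtains T where "T \<subseteq> V" "mono3 r T"
proof (rule ccontr)
  assume "\<not> thesis"
  with that have no: "\<not> mono3 r T" if "T \<subseteq> V" for T using \<open>T \<subseteq> V\<close> by blast
  obtain W where W: "W \<subseteq> V" "card W = 6" using V obtain_subset_with_card_n by metis
  then obtain a P where aP: "W = insert a P" "a \<notin> P" "card P = 5"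
    using card_eq_SucD[of W 5] by auto
  have "\<not> mono3 r T" if "T \<subseteq> P" for T using no that aP(1) W(1) by blast
  then obtain p q s t u where p: "pentagon r p q s t u" and P: "P = {p, q, s, t, u}"
    using pentagon_exists[OF r aP(3)] by metis
  have n: "\<not> (r a x = r x y \<and> r x y = r a y)" if "{x, y} \<subseteq> P" "x \<noteq> y" for x y
  proof -
    have "{a, x, y} \<subseteq> V" "distinct [a, x, y]" using that aP W by auto
    then show ?thesis using no mono3_triple[OF r] by blast
  qed
  obtain p' q' s' t' u' where p': "pentagon r p' q' s' t' u'"
    "{p', q', s', t', u'} = P" "r a p'" "r a q'"
    using pentagon_extend[OF r p, of a] n aP(2) unfolding P by metis
  then show False using n[of p' q'] by (auto simp: pentagon_def)
qed

section \<open>Two disjoint triangles on eight vertices\<close>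

text \<open>Since \<open>a p q\<close> is a red triangle, \<open>b c s t u\<close> contains none of
  either colour. This makes \<open>b\<close> and \<open>c\<close> red to \<open>p\<close> and
  \<open>q\<close> and matches them in red with \<open>s\<close> and \<open>u\<close>, which
  completes red triangles on the sides \<open>q s\<close> and \<open>p u\<close>.\<close>

lemma two_disjoint_mono3_aux:
  assumes r: "symp r" and d: "distinct [a, b, c, p, q, s, t, u]"
    and bc: "r b c" and p: "pentagon r p q s t u" and a: "r a p" "r a q"
    and noblue: "\<And>x y z. x \<in> {b, c} \<Longrightarrow> {y, z} \<subseteq> {p, q, s, t, u} \<Longrightarrow>
      \<not> r y z \<Longrightarrow> \<not> r x y \<Longrightarrow> \<not> r x z \<Longrightarrow> y = z"
    and no: "\<And>T T'. mono3 r T \<Longrightarrow> mono3 r T' \<Longrightarrow>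
      T \<union> T' \<subseteq> {a, b, c, p, q, s, t, u} \<Longrightarrow> T \<inter> T' \<noteq> {}"
  shows False
proof -
  have sym: "r x y \<longleftrightarrow> r y x" for x y using r by (auto simp: symp_def)
  have E: "r p q" "r q s" "r s t" "r t u" "r u p"
     "\<not> r p s" "\<not> r s u" "\<not> r u q" "\<not> r q t" "\<not> r t p"
    using p by (auto simp: pentagon_def)
  have "mono3 r {a, p, q}" using d E a by (subst mono3_triple[OF r]) auto
  then have n: "\<not> mono3 r T" if "T \<subseteq> {b, c, s, t, u}" for T
    using no[of "{a, p, q}" T] d that by auto
  have m: "\<not> (r x y = r y z \<and> r y z = r x z)"
    if "distinct [x, y, z]" "{x, y, z} \<subseteq> {b, c, s, t, u}" for x y z
    using mono3_triple[OF r that(1)] n[OF that(2)] by blast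
  \<comment> \<open>A red \<open>x t\<close> would make \<open>x s\<close> and \<open>x u\<close>
    blue, closing a blue triangle with the diagonal \<open>s u\<close>.\<close>
  have *: "\<not> r x t" if "x \<in> {b, c}" for x
    using m[of x s t] m[of x t u] m[of x s u] that d E by auto
  have blue: "r x p" "r x q" if "x \<in> {b, c}" for x
    using noblue[OF that, of t p] noblue[OF that, of t q] *[OF that] d E sym by auto
  have "r b s \<or> r b u" "r c s \<or> r c u" "\<not> (r b s \<and> r c s)" "\<not> (r b u \<and> r c u)"
    using m[of b s u] m[of c s u] m[of b c s] m[of b c u] d E bc by auto
  then consider "r b s" "r c u" | "r c s" "r b u" by blast
  then show False
  proof cases
    case 1
    then have "mono3 r {b, q, s}" "mono3 r {c, p, u}"
      using d E blue sym by (auto simp: mono3_triple[OF r])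
    then show False using no[of "{b, q, s}" "{c, p, u}"] d by auto
  next
    case 2
    then have "mono3 r {c, q, s}" "mono3 r {b, p, u}"
      using d E blue sym by (auto simp: mono3_triple[OF r])
    then show False using no[of "{c, q, s}" "{b, p, u}"] d by auto
  qed
qed

text \<open>If \<open>axy\<close> is blue for a diagonal \<open>xy\<close> of the pentagon, then the vertex between \<open>x\<close> and
  \<open>y\<close> forces one of \<open>b\<close>, \<open>c\<close> into a second triangle.\<close>

lemma no_blue_cone:
  assumes r: "symp r" and d: "distinct [a, b, c, p, q, s, t, u]"
    and bc: "r b c" and p: "pentagon r p q s t u"
    and no: "\<And>T T'. mono3 r T \<Longrightarrow> mono3 r T' \<Longrightarrow>
      T \<union> T' \<subseteq> {a, b, c, p, q, s, t, u} \<Longrightarrow> T \<inter> T' \<noteq> {}"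
  shows "r a p \<or> r a s"
proof (rule ccontr)
  assume A: "\<not> (r a p \<or> r a s)"
  have sym: "r x y \<longleftrightarrow> r y x" for x y using r by (auto simp: symp_def)
  have E: "r p q" "r q s" "r s t" "r t u" "r u p"
     "\<not> r p s" "\<not> r s u" "\<not> r u q" "\<not> r q t" "\<not> r t p"
    using p by (auto simp: pentagon_def)
  have "mono3 r {a, p, s}" using d E A by (subst mono3_triple[OF r]) auto
  then have n: "\<not> mono3 r T" if "T \<subseteq> {b, c, q, t, u}" for T
    using no[of "{a, p, s}" T] d that by auto
  have m: "\<not> (r x y = r y z \<and> r y z = r x z)"
    if "distinct [x, y, z]" "{x, y, z} \<subseteq> {b, c, q, t, u}" for x y z
    using mono3_triple[OF r that(1)] n[OF that(2)] by blast
  have qu: "\<not> r q u" using E sym by blast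
  note M = m[of b c q] m[of b c t] m[of b c u] m[of b q t] m[of b q u] m[of b t u]
    m[of c q t] m[of c q u] m[of c t u]
  show False
  \<comment> \<open>Both \<open>q t\<close> and \<open>q u\<close> are blue, so whichever of
    \<open>b\<close>, \<open>c\<close> is blue to \<open>q\<close> must be red to \<open>t\<close>
    and \<open>u\<close>, a triangle with the red side \<open>t u\<close>. As \<open>b c\<close> is
    red, one of them is blue to \<open>q\<close>.\<close>
  proof (cases "r b q")
    case True
    then have "\<not> r c q" using M(1) bc sym d by auto
    then have "r c t" "r c u" using M(7,8) E qu d by auto
    then show False using M(9) E d by auto
  next
    case False
    then have "r b t" "r b u" using M(4,5) E qu d by auto
    then show False using M(6) E d by auto
  qed
qed

lemma two_disjoint_mono3:
  assumes r: "symp r" and V: "card V = 8"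
  obtains T T' where "T \<subseteq> V" "T' \<subseteq> V" "mono3 r T" "mono3 r T'" "T \<inter> T' = {}"
proof (rule ccontr)
  assume "\<not> thesis"
  with that have no0: "T \<inter> T' \<noteq> {}" if "mono3 r T" "mono3 r T'" "T \<union> T' \<subseteq> V" for T T'
    using \<open>mono3 r T\<close> \<open>mono3 r T'\<close> \<open>T \<union> T' \<subseteq> V\<close> by blast
  obtain T where T: "T \<subseteq> V" "mono3 r T" using mono3_exists[OF r, of V] V by auto
  then obtain col where col: "\<forall>u\<in>T. \<forall>v\<in>T. u \<noteq> v \<longrightarrow> r u v = col" and T3: "card T = 3"
    by (auto simp: mono3_def)
  \<comment> \<open>\<open>g\<close> is \<open>r\<close> with the colours exchanged if necessary, so
    that \<open>T\<close> is red.\<close>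
  define g where "g = (if col then r else (\<lambda>u v. \<not> r u v))"
  have g: "symp g" using r by (auto simp: g_def symp_def)
  have mono: "mono3 g T \<longleftrightarrow> mono3 r T" for T by (simp add: g_def mono3_compl)
  have Tg: "g u v" if "u \<in> T" "v \<in> T" "u \<noteq> v" for u v
    using col that by (auto simp: g_def)
  obtain a b c where abc: "T = {a, b, c}" "distinct [a, b, c]"
    using T3 by (auto simp: card_3_iff)
  have finV: "finite V" using V card.infinite by fastforce
  have "card (V - T) = 5" using V T T3 finV by (simp add: card_Diff_subset finite_subset)
  moreover have "\<not> mono3 g S" if "S \<subseteq> V - T" for S
    using no0[of T S] T that by (auto simp: mono)
  ultimately obtain p q s t u where p: "pentagon g p q s t u" and P: "V - T = {p, q, s, t, u}"
    using pentagon_exists[OF g, of "V - T"] by metis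
  have V': "V = T \<union> {p, q, s, t, u}" and dj: "T \<inter> {p, q, s, t, u} = {}" using P T by blast+
  have no: "A \<inter> B \<noteq> {}" if "mono3 g A" "mono3 g B" "A \<union> B \<subseteq> V" for A B
    using no0 that by (simp add: mono)
  have cone: "g x p' \<or> g x s'"
    if "pentagon g p' q' s' t' u'" "{p', q', s', t', u'} = {p, q, s, t, u}" "x \<in> T"
    for x p' q' s' t' u'
  proof -
    obtain y z where yz: "T = {x, y, z}" "distinct [x, y, z]"
      using abc \<open>x \<in> T\<close> by (auto simp: insert_commute)
    have V2: "V = {x, y, z, p', q', s', t', u'}" using V' that(2) yz(1) by auto
    have "distinct [x, y, z, p', q', s', t', u']"
      using that(1) yz dj unfolding that(2)[symmetric] pentagon_def by auto
    moreover have "g y z" using Tg yz by auto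
    ultimately show ?thesis using no_blue_cone[OF g _ _ that(1), of x y z] no V2 by metis
  qed
  have noblue: "y = z"
    if "x \<in> T" "{y, z} \<subseteq> {p, q, s, t, u}" "\<not> g y z" "\<not> g x y" "\<not> g x z" for x y z
  proof (rule ccontr)
    assume "y \<noteq> z"
    have "g x p \<or> g x s" "g x q \<or> g x t" "g x s \<or> g x u" "g x t \<or> g x p" "g x u \<or> g x q"
      by (rule cone[OF p _ \<open>x \<in> T\<close>] pentagon_rotate[OF p, THEN cone, OF _ \<open>x \<in> T\<close>],
          simp add: insert_commute)+
    moreover have "g p q" "g q s" "g s t" "g t u" "g u p" "g q p" "g s q" "g t s" "g u t" "g p u"
      using p g by (auto simp: pentagon_def symp_def)
    then have "{y, z} \<in> {{p, s}, {q, t}, {s, u}, {t, p}, {u, q}}"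
      using that(2,3) \<open>y \<noteq> z\<close> by (auto simp: insert_commute)
    ultimately show False using that(4,5) by (auto simp: doubleton_eq_iff)
  qed
  have "a \<in> T" and aP: "a \<notin> {p, q, s, t, u}" using abc dj by auto
  obtain p' q' s' t' u' where p': "pentagon g p' q' s' t' u'"
    "{p', q', s', t', u'} = {p, q, s, t, u}" "g a p'" "g a q'"
    using pentagon_extend[OF g p aP] noblue[OF \<open>a \<in> T\<close>] by metis
  have V2: "V = {a, b, c, p', q', s', t', u'}" using V' p'(2) abc(1) by auto
  have d: "distinct [a, b, c, p', q', s', t', u']"
    using p'(1) abc dj unfolding p'(2)[symmetric] pentagon_def by auto
  show False
  proof (rule two_disjoint_mono3_aux[OF g d _ p'(1,3,4)])
    show "g b c" using Tg abc by auto
    show "y = z" if "x \<in> {b, c}" "{y, z} \<subseteq> {p', q', s', t', u'}" "\<not> g y z" "\<not> g x y" "\<not> g x z"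
      for x y z using noblue[of x y z] that abc(1) p'(2) by auto
    show "A \<inter> B \<noteq> {}"
      if "mono3 g A" "mono3 g B" "A \<union> B \<subseteq> {a, b, c, p', q', s', t', u'}" for A B
      using no that V2 by metis
  qed
qed

section \<open>Induction on the number of triangles\<close>

text \<open>The induction starts at \<open>2\<close> because for \<open>k = 1\<close> the count
  would be five, where the pentagon has no monochromatic triangle.\<close>

lemma disjoint_mono3_family:
  assumes r: "symp r" and "k \<ge> 2" "card V = 3 * k + 2"
  shows "\<exists>S. finite S \<and> card S = k \<and> pairwise disjnt S \<and> (\<forall>T\<in>S. T \<subseteq> V \<and> mono3 r T)"
  using assms(2,3)
proof (induction k arbitrary: V rule: dec_induct)
  case base
  then have "card V = 8" by simp
  then obtain T T' where T: "T \<subseteq> V" "T' \<subseteq> V" "mono3 r T" "mono3 r T'" "T \<inter> T' = {}"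
    by (rule two_disjoint_mono3[OF r])
  then have "T \<noteq> T'" by (auto simp: mono3_def)
  with T show ?case
    by (intro exI[of _ "{T, T'}"]) (auto simp: pairwise_insert disjnt_def)
next
  case (step k)
  have "card V \<ge> 6" using step by simp
  then obtain T where T: "T \<subseteq> V" "mono3 r T" by (rule mono3_exists[OF r])
  have finV: "finite V" using step.prems card.infinite by fastforce
  have T3: "card T = 3" using T by (simp add: mono3_def)
  have "card (V - T) = 3 * k + 2"
    using finV T T3 step.prems by (simp add: card_Diff_subset finite_subset)
  from step.IH[OF this] obtain S where S: "finite S" "card S = k" "pairwise disjnt S"
    "\<forall>T'\<in>S. T' \<subseteq> V - T \<and> mono3 r T'" by blast
  have "T \<noteq> {}" using T3 by auto
  then have "T \<notin> S" using S(4) by blast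
  then have "card (insert T S) = Suc k" using S by simp
  moreover have "pairwise disjnt (insert T S)"
    using S(3,4) unfolding pairwise_insert by (auto simp: disjnt_def)
  moreover have "\<forall>T'\<in>insert T S. T' \<subseteq> V \<and> mono3 r T'" using S(4) T by blast
  ultimately show ?case using S(1) by blast
qed

section \<open>From vertex triples to coloured subgraphs\<close>

lemma graph_iso_complete_graph:
  assumes "finite T" "card T = n"
  shows "graph_iso (T, [T]\<^bsup>2\<^esup>) (complete_graph n)"
proof -
  obtain f where f: "bij_betw f T {..<n}"
    using finite_same_card_bij[of T "{..<n}"] assms by auto
  then have "bij_betw (\<lambda>e. f ` e) ([T]\<^bsup>2\<^esup>) ([{..<n}]\<^bsup>2\<^esup>)"
    by (rule bij_betw_nsets)
  with f show ?thesis
    unfolding graph_iso_def complete_graph_def by (auto simp: bij_betw_def)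
qed

lemma graph_iso_complete_graphD:
  assumes "simple_graph H" "graph_iso H (complete_graph n)"
  shows "card (verts H) = n" "edges H = [verts H]\<^bsup>2\<^esup>"
proof -
  obtain f where f: "bij_betw f (verts H) {..<n}" "(\<lambda>e. f ` e) ` edges H = [{..<n}]\<^bsup>2\<^esup>"
    using assms by (auto simp: graph_iso_def complete_graph_def)
  show "card (verts H) = n" using bij_betw_same_card[OF f(1)] by simp
  have sub: "edges H \<subseteq> [verts H]\<^bsup>2\<^esup>" using assms by (simp add: simple_graph_def)
  have b: "bij_betw (\<lambda>e. f ` e) ([verts H]\<^bsup>2\<^esup>) ([{..<n}]\<^bsup>2\<^esup>)"
    using f(1) by (rule bij_betw_nsets)
  \<comment> \<open>The edges and the set of all vertex pairs have the same image under an injective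
    map, so they coincide.\<close>
  then show "edges H = [verts H]\<^bsup>2\<^esup>"
    using f(2) sub by (metis bij_betw_def inj_on_image_eq_iff order_refl)
qed

lemma forces_disjoint_triangles:
  assumes "k \<ge> 2"
  shows "forces_disjoint_copies (complete_graph 3) (complete_graph 3) k (3 * k + 2)"
  unfolding forces_disjoint_copies_def
proof
  fix c :: "nat set \<Rightarrow> colour"
  define r where "r = (\<lambda>u v. c {u, v} = Red)"
  have r: "symp r" by (auto simp: r_def symp_def insert_commute)
  obtain S where S: "finite S" "card S = k" "pairwise disjnt S"
    and tri: "\<And>T. T \<in> S \<Longrightarrow> T \<subseteq> {..<3 * k + 2}" "\<And>T. T \<in> S \<Longrightarrow> mono3 r T"
    using disjoint_mono3_family[OF r assms, of "{..<3 * k + 2}"] by auto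
  define K :: "nat set \<Rightarrow> nat graph" where "K = (\<lambda>T. (T, [T]\<^bsup>2\<^esup>))"
  have "inj_on K S" by (auto simp: inj_on_def K_def)
  then have card: "card (K ` S) = k" using S by (simp add: card_image)
  have disj: "pairwise (\<lambda>H H'. verts H \<inter> verts H' = {}) (K ` S)"
    using S(3) by (auto simp: pairwise_def disjnt_def K_def)
  have good: "subgraph (K T) (complete_graph (3 * k + 2)) \<and>
      coloured_copy c (complete_graph 3) (complete_graph 3) (K T)" if "T \<in> S" for T
  proof
    have T: "T \<subseteq> {..<3 * k + 2}" "card T = 3" "finite T"
      using tri[OF that] finite_subset by (auto simp: mono3_def)
    then show "subgraph (K T) (complete_graph (3 * k + 2))"
      using nsets_mono[OF T(1), of 2]
      by (auto simp: subgraph_def simple_graph_def complete_graph_def K_def)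
    have iso: "graph_iso (K T) (complete_graph 3)"
      unfolding K_def using T by (intro graph_iso_complete_graph)
    obtain i where i: "\<forall>u\<in>T. \<forall>v\<in>T. u \<noteq> v \<longrightarrow> r u v = i"
      using tri(2)[OF \<open>T \<in> S\<close>] by (auto simp: mono3_def)
    have "c e = (if i then Red else Blue)" if "e \<in> [T]\<^bsup>2\<^esup>" for e
    proof -
      obtain u v where "e = {u, v}" "u \<in> T" "v \<in> T" "u \<noteq> v"
        using \<open>e \<in> [T]\<^bsup>2\<^esup>\<close> by (auto simp: nsets_2_eq)
      then show ?thesis using i by (cases "c e") (auto simp: r_def)
    qed
    then have "all_edges_coloured c (if i then Red else Blue) (K T)"
      by (auto simp: all_edges_coloured_def K_def)
    with iso show "coloured_copy c (complete_graph 3) (complete_graph 3) (K T)"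
      unfolding coloured_copy_def by (cases i) auto
  qed
  show "\<exists>F. finite F \<and> card F \<ge> k \<and> pairwise (\<lambda>H H'. verts H \<inter> verts H' = {}) F \<and>
      (\<forall>H\<in>F. subgraph H (complete_graph (3 * k + 2)) \<and>
         coloured_copy c (complete_graph 3) (complete_graph 3) H)"
    using S(1) card disj good by (intro exI[of _ "K ` S"]) auto
qed

section \<open>The extremal colouring\<close>

lemma forces_disjoint_triangles_lower:
  assumes "k \<ge> 1" and F: "forces_disjoint_copies (complete_graph 3) (complete_graph 3) k p"
  shows "p \<ge> 3 * k + 2"
proof -
  \<comment> \<open>The special vertices are \<open>0\<close> and \<open>1\<close>; the blue edges
    are those between them and the rest, a bipartite graph.\<close>
  define c where "c = (\<lambda>e :: nat set. if card (e \<inter> {0, 1}) = 1 then Blue else Red)"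
  obtain F where F: "finite F" "card F \<ge> k"
    and disj: "pairwise (\<lambda>H H'. verts H \<inter> verts H' = {}) F"
    and sub: "\<And>H. H \<in> F \<Longrightarrow> subgraph H (complete_graph p)"
    and cop: "\<And>H. H \<in> F \<Longrightarrow> coloured_copy c (complete_graph 3) (complete_graph 3) H"
    using F unfolding forces_disjoint_copies_def by metis
  have H: "card (verts H) = 3 \<and> verts H \<subseteq> {2..<p}" if "H \<in> F" for H
  proof
    have simple: "simple_graph H" and "verts H \<subseteq> {..<p}"
      using sub[OF that] by (auto simp: subgraph_def complete_graph_def)
    have iso: "graph_iso H (complete_graph 3)"
      using cop[OF that] by (auto simp: coloured_copy_def)
    show c3: "card (verts H) = 3" using graph_iso_complete_graphD[OF simple iso] by simp
    obtain x where x: "\<forall>e\<in>edges H. c e = x"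
      using cop[OF \<open>H \<in> F\<close>] by (auto simp: coloured_copy_def all_edges_coloured_def)
    have mono: "c {u, v} = x" if "u \<in> verts H" "v \<in> verts H" "u \<noteq> v" for u v
      using x that unfolding graph_iso_complete_graphD(2)[OF simple iso] by (auto simp: nsets_2_eq)
    obtain u v w where uvw: "verts H = {u, v, w}" "u \<noteq> v" "u \<noteq> w" "v \<noteq> w"
      using c3 by (auto simp: card_3_iff)
    have colour: "c {y, z} = (if (y < 2) = (z < 2) then Red else Blue)" if "y \<noteq> z" for y z
    proof -
      have "{y, z} \<inter> {0, 1} = (if y < 2 then {y} else {}) \<union> (if z < 2 then {z} else {})"
        by auto
      then show ?thesis using that by (auto simp: c_def)
    qed
    \<comment> \<open>Three blue edges would need three vertices on pairwise different sides of a
      bipartition, so all are red and the vertices share a side. The side below \<open>2\<close> has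
      only two vertices.\<close>
    have "c {u, v} = c {v, w}" "c {v, w} = c {u, w}" using mono uvw by auto
    then have "(u < 2) = (v < 2)" "(v < 2) = (w < 2)"
      using uvw by (auto simp: colour split: if_splits)
    then have "u \<ge> 2 \<and> v \<ge> 2 \<and> w \<ge> 2" using uvw by linarith
    then show "verts H \<subseteq> {2..<p}" using uvw \<open>verts H \<subseteq> {..<p}\<close> by auto
  qed
  have "card (\<Union>H\<in>F. verts H) = (\<Sum>H\<in>F. card (verts H))"
  proof (rule card_UN_disjoint)
    show "\<forall>H\<in>F. finite (verts H)" using H finite_subset by blast
    show "\<forall>H\<in>F. \<forall>H'\<in>F. H \<noteq> H' \<longrightarrow> verts H \<inter> verts H' = {}"
      using disj by (auto simp: pairwise_def)
  qed (rule F)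
  also have "\<dots> = 3 * card F" using H by simp
  finally have "3 * card F = card (\<Union>H\<in>F. verts H)" by simp
  also have "\<dots> \<le> card {2..<p}" using H by (intro card_mono) auto
  \<comment> \<open>Positivity of \<open>k\<close> ensures that the truncated difference
    \<open>p - 2\<close> is a true one.\<close>
  finally show ?thesis using F(2) assms(1) by simp
qed

theorem theorem3p7:
  fixes k :: nat
  assumes "k \<ge> 2"
  shows "disjoint_ramsey (complete_graph 3) (complete_graph 3) k = 3 * k + 2"
  unfolding disjoint_ramsey_def
proof (rule Least_equality)
  show "forces_disjoint_copies (complete_graph 3) (complete_graph 3) k (3 * k + 2)"
    using assms by (rule forces_disjoint_triangles)
  show "3 * k + 2 \<le> p"
    if "forces_disjoint_copies (complete_graph 3) (complete_graph 3) k p" for p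
    using forces_disjoint_triangles_lower[OF _ that] assms by simp
qed

end
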